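(* Let $n\in\{0,1,2,\dots\}$, let $\mu\in\mathbb{C}$ with $\operatorname{Re}(\mu)>-\frac12$, and let $b\in[0,1)$. Then $$\int_{E_2}\left(\cos\phi_{E_2}(x)\right)^{2n+1}\left(1-\cos^2\phi_{E_2}(x)\right)^{\mu}w_{E_2}(x)\,dx = b\,\frac{\Gamma(n+1)\,\Gamma(\mu+\frac12)}{\Gamma(\mu+n+\frac32)}\;{}_2F_1\!\left(\tfrac12,\ \mu+\tfrac12;\ \mu+n+\tfrac32;\ 1-b^2\right).$$
   Context: For $b\in[0,1)$ put $E_2:=[-1,-b]\cup[b,1]$. For (almost every) $x\in E_2$ define $$\cos\phi_{E_2}(x):=\sqrt{\frac{x^2-b^2}{1-b^2}}\,\frac{x}{|x|},\qquad w_{E_2}(x):=\sqrt{\frac{x+b}{(1-x^2)(x-b)}}.$$ Here $\cos\phi_{E_2}$ is just the name of a real-valued function, $\cos^2\phi_{E_2}(x)$ means $(\cos\phi_{E_2}(x))^2$, and square roots of nonnegative reals are nonnegative. For $t>0$, $t^\mu=e^{\mu\log t}$ with the real logarithm. The function ${}_2F_1(\alpha,\beta;\gamma;z)=\sum_{k\ge0}\frac{(\alpha)_k(\beta)_k}{(\gamma)_k\,k!}z^k$ is the Gauss hypergeometric function, with $(a)_0:=1$, $(a)_k:=a(a+1)\cdots(a+k-1)$ (the series also converges at $z=1$ for the parameters above). *)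

theory Defs
  imports "HOL-Analysis.Analysis"
begin

definition E2 :: "real \<Rightarrow> real set" where
  "E2 b = {-1..-b} \<union> {b..1}"

definition cos_phi_E2 :: "real \<Rightarrow> real \<Rightarrow> real" where
  "cos_phi_E2 b x = sqrt ((x\<^sup>2 - b\<^sup>2) / (1 - b\<^sup>2)) * (x / \<bar>x\<bar>)"

(* For x in E2 b one has 1 - (cos_phi_E2 b x)^2 = (1 - x^2) / (1 - b^2) > 0 unless x = 1 or
   x = -1 (at x = 0, b = 0, the convention 0 / 0 = 0 gives 1 as well). Hence the
   principal complex power (1 - (cos_phi_E2 b x)^2) powr mu is the power formed with the real
   logarithm for almost every x. *)

definition w_E2 :: "real \<Rightarrow> real \<Rightarrow> real" where
  "w_E2 b x = sqrt ((x + b) / ((1 - x\<^sup>2) * (x - b)))"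

definition hypergeo_2F1_term :: "complex \<Rightarrow> complex \<Rightarrow> complex \<Rightarrow> complex \<Rightarrow> nat \<Rightarrow> complex" where
  "hypergeo_2F1_term \<alpha> \<beta> \<gamma> z k =
     pochhammer \<alpha> k * pochhammer \<beta> k / (pochhammer \<gamma> k * fact k) * z ^ k"

definition hypergeo_2F1 :: "complex \<Rightarrow> complex \<Rightarrow> complex \<Rightarrow> complex \<Rightarrow> complex" where
  "hypergeo_2F1 \<alpha> \<beta> \<gamma> z = (\<Sum>k. hypergeo_2F1_term \<alpha> \<beta> \<gamma> z k)"

end

theory Submission
  imports Defs
begin

text \<open>
  For \<open>b < \<bar>y\<bar> < 1\<close> put \<open>t = (1 - y\<^sup>2) / (1 - b\<^sup>2)\<close>, so that \<open>cos\<^sup>2 \<phi> = 1 - t\<close>. The square roots in the cosine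
  and in the weight combine to a factor that is linear in \<open>y\<close> with the same formula on both components of
  \<open>E2 b\<close>: the integrand is \<open>(y + b) / (1 - b\<^sup>2) * t powr (\<mu> - 1/2) * (1 - t) ^ n\<close>
  (lemma \<open>integrand_E2_eq\<close>). Since \<open>t\<close> is even in \<open>y\<close>, adding the values at \<open>x\<close> and \<open>- x\<close> cancels
  the part proportional to \<open>y\<close> and doubles the part proportional to \<open>b\<close>. On \<open>b < x < 1\<close> one has
  \<open>x = sqrt (1 - z * t)\<close> with \<open>z = 1 - b\<^sup>2\<close>, so the substitution \<open>x \<mapsto> t\<close>
  (lemma \<open>set_integral_substitution_E2\<close>) turns the integral into
  \<open>b\<close> times the integral over \<open>0 < t < 1\<close> of \<open>t powr (\<mu> - 1/2) * (1 - t) ^ n * (1 - z * t) powr (- 1/2)\<close>,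
  which is Euler's integral for the hypergeometric function.

  Euler's formula (lemma \<open>euler_integral_2F1\<close>) comes from expanding \<open>(1 - z * t) powr (- s)\<close> by the binomial
  series and integrating termwise. All coefficients of that series are nonnegative, so its partial sums are bounded by
  its value, which is at most \<open>(1 - t) powr (- s)\<close>; an integrable beta kernel therefore dominates
  them uniformly in \<open>z \<le> 1\<close>. Hence the boundary value \<open>z = 1\<close>, that is \<open>b = 0\<close>, needs no
  separate treatment, and dominated convergence yields the convergence of the hypergeometric series
  along with its sum. The terms are beta integrals with a natural number as second exponent, which
  have the elementary value \<open>fact n / pochhammer a (Suc n)\<close>.
\<close>

section \<open>Beta integrals with a complex exponent\<close>

text \<open>
  The branch cut of the logarithm keeps this from being a continuity argument; on the real line
  the logarithm is explicit on each side of the origin.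
\<close>
lemma borel_measurable_complex_of_real_powr [measurable]:
  fixes a :: complex
  assumes [measurable]: "f \<in> borel_measurable M"
  shows "(\<lambda>x. complex_of_real (f x) powr a) \<in> borel_measurable M"
proof -
  have "complex_of_real t powr a = (if t = 0 then 0 else
          exp (a * (complex_of_real (ln \<bar>t\<bar>) + (if t < 0 then \<i> * complex_of_real pi else 0))))" for t
    using Ln_of_real[of t] Ln_of_real[of "- t"] Ln_minus[of "complex_of_real (- t)"]
    by (auto simp: powr_def)
  thus ?thesis by (simp only:) measurable
qed

lemma set_integrable_beta_kernel:
  fixes a :: complex and c :: real
  assumes "Re a > 0" "c > 0"
  shows "set_integrable lborel {0<..<1}
           (\<lambda>t. complex_of_real t powr (a - 1) * complex_of_real ((1 - t) powr (c - 1)))"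
proof (rule set_integrable_bound)
  show "set_integrable lborel {0<..<1} (\<lambda>t. t powr (Re a - 1) * (1 - t) powr (c - 1))"
    using integrable_Beta[of "Re a" c] assms by (auto intro: set_integrable_subset)
  show "set_borel_measurable lborel {0<..<1}
          (\<lambda>t. complex_of_real t powr (a - 1) * complex_of_real ((1 - t) powr (c - 1)))"
    unfolding set_borel_measurable_def by measurable
  show "AE t in lborel. t \<in> {0<..<1} \<longrightarrow>
          norm (complex_of_real t powr (a - 1) * complex_of_real ((1 - t) powr (c - 1)))
          \<le> norm (t powr (Re a - 1) * (1 - t) powr (c - 1))"
    by (auto simp: norm_mult norm_powr_real_powr)
qed

lemma set_integrable_beta_kernel_nat:
  fixes a :: complex
  assumes "Re a > 0"
  shows "set_integrable lborel {0<..<1}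
           (\<lambda>t. complex_of_real t powr (a - 1) * (1 - complex_of_real t) ^ n)"
proof -
  have "set_integrable lborel {0<..<1}
           (\<lambda>t. complex_of_real t powr (a - 1) * complex_of_real ((1 - t) powr (real (Suc n) - 1)))"
    using assms by (intro set_integrable_beta_kernel) auto
  also have "?this \<longleftrightarrow> ?thesis"
    by (intro set_integrable_cong) (auto simp: powr_realpow)
  finally show ?thesis .
qed

text \<open>
  The factor \<open>1 - t\<close> splits an integrand of exponent \<open>Suc n\<close> into two of exponent \<open>n\<close>, with
  parameters \<open>a\<close> and \<open>a + 1\<close>; the claimed values satisfy the same recurrence.
\<close>
lemma integral_beta_kernel_nat:
  fixes a :: complex
  assumes "Re a > 0"
  shows "(LINT t:{0<..<1}|lborel. complex_of_real t powr (a - 1) * (1 - complex_of_real t) ^ n)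
           = fact n / pochhammer a (Suc n)"
  using assms
proof (induction n arbitrary: a)
  case 0
  have "((\<lambda>t. complex_of_real t powr (a - 1)) has_integral
          (of_real 1 powr a / a - of_real 0 powr a / a)) {0..1}" using 0
    by (intro fundamental_theorem_of_calculus_interior)
       (auto intro!: continuous_intros derivative_eq_intros has_vector_derivative_real_field)
  hence "((\<lambda>t. complex_of_real t powr (a - 1)) has_integral 1 / a) {0<..<1}"
    by (simp add: has_integral_Icc_iff_Ioo)
  thus ?case
    using set_borel_integral_eq_integral(2)[OF set_integrable_beta_kernel_nat[OF 0, of 0]]
    by (simp add: integral_unique)
next
  case (Suc n)
  have int: "set_integrable lborel {0<..<1}
          (\<lambda>t. complex_of_real t powr (a - 1) * (1 - complex_of_real t) ^ n)"
       "set_integrable lborel {0<..<1}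
          (\<lambda>t. complex_of_real t powr (a + 1 - 1) * (1 - complex_of_real t) ^ n)"
    using Suc.prems by (intro set_integrable_beta_kernel_nat; simp)+
  have nz: "a + of_nat k \<noteq> 0" for k
    using Suc.prems by (auto simp: complex_eq_iff)
  have nz': "pochhammer (a + 1) n \<noteq> 0" "a \<noteq> 0"  "1 + (a + of_nat n) \<noteq> 0"
    using nz[of "Suc _"] nz[of 0] nz[of "Suc n"] by (auto simp: pochhammer_eq_0_iff add_ac eq_neg_iff_add_eq_0)
  have "(LINT t:{0<..<1}|lborel. complex_of_real t powr (a - 1) * (1 - complex_of_real t) ^ Suc n)
      = (LINT t:{0<..<1}|lborel. complex_of_real t powr (a - 1) * (1 - complex_of_real t) ^ n
            - complex_of_real t powr (a + 1 - 1) * (1 - complex_of_real t) ^ n)"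
    by (intro set_lebesgue_integral_cong) (auto simp: powr_diff field_simps)
  also have "\<dots> = fact n / pochhammer a (Suc n) - fact n / pochhammer (a + 1) (Suc n)"
    using Suc.prems
    by (subst set_integral_diff(2)[OF int], subst Suc.IH, simp, subst Suc.IH) simp_all
  also have "\<dots> = fact (Suc n) / pochhammer a (Suc (Suc n))"
  proof -
    have "pochhammer a (Suc n) = a * pochhammer (a + 1) n"
         "pochhammer (a + 1) (Suc n) = pochhammer (a + 1) n * (a + of_nat n + 1)"
         "pochhammer a (Suc (Suc n)) = a * pochhammer (a + 1) n * (a + of_nat n + 1)"
      using pochhammer_rec[of a "Suc n"] pochhammer_rec[of a n] pochhammer_Suc[of "a + 1" n]
      by (simp_all only: add_ac mult_ac)
    thus ?thesis using nz' by (simp add: divide_simps add_ac) (simp add: algebra_simps)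
  qed
  finally show ?case .
qed

section \<open>Euler's integral for the hypergeometric function\<close>

text \<open>
  Both ways of cutting \<open>pochhammer a (k + m)\<close> in two agree. This turns the beta integral with
  parameter \<open>a + k\<close> into a constant times the \<open>k\<close>-dependent factor of the hypergeometric term.
\<close>
lemma pochhammer_shift_quotient:
  fixes a :: complex
  assumes "Re a > 0"
  shows "1 / pochhammer (a + of_nat k) m = pochhammer a k / (pochhammer a m * pochhammer (a + of_nat m) k)"
proof -
  have "a \<noteq> - of_nat j"  "a + of_nat m \<noteq> - of_nat j"  "a + of_nat k \<noteq> - of_nat j" for m j
    using assms by (auto simp: complex_eq_iff)
  hence nz: "pochhammer a m \<noteq> 0" "pochhammer (a + of_nat m) k \<noteq> 0" "pochhammer (a + of_nat k) m \<noteq> 0"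
    by (auto simp: pochhammer_eq_0_iff)
  have "pochhammer a k * pochhammer (a + of_nat k) m = pochhammer a m * pochhammer (a + of_nat m) k"
    by (metis pochhammer_product' add.commute)
  thus ?thesis using nz by (simp add: field_simps)
qed

lemma one_minus_powr_sums:
  fixes s z :: real
  assumes "\<bar>z\<bar> < 1"
  shows "(\<lambda>k. pochhammer s k / fact k * z ^ k) sums (1 - z) powr (- s)"
proof -
  have "((- s) gchoose k) * (- z) ^ k = pochhammer s k / fact k * z ^ k" for k
    by (simp add: gbinomial_pochhammer flip: power_mult_distrib mult.assoc)
  thus ?thesis using gen_binomial_real[of "- z" "- s"] assms by simp
qed

text \<open>
  The condition \<open>s < n + 1\<close> is what makes the dominating function
  \<open>t powr (Re a - 1) * (1 - t) powr (n - s)\<close> integrable up to \<open>t = 1\<close>; it is also the condition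
  for the series to converge at \<open>z = 1\<close>.
\<close>
lemma euler_integral_2F1:
  fixes a :: complex and s z :: real
  assumes a: "Re a > 0" and s: "0 < s" "s < real (Suc n)" and z: "0 \<le> z" "z \<le> 1"
  defines "h \<equiv> \<lambda>t. complex_of_real t powr (a - 1) * (1 - complex_of_real t) ^ n
                     * complex_of_real ((1 - z * t) powr (- s))"
  shows "set_integrable lborel {0<..<1} h"
    and "hypergeo_2F1_term (of_real s) a (a + of_nat (Suc n)) (of_real z) sums
           (pochhammer a (Suc n) / fact n * (LINT t:{0<..<1}|lborel. h t))"
proof -
  \<comment> \<open>\<open>f k\<close> are the terms of the binomial expansion of \<open>h\<close>, and \<open>w\<close> dominates their partial sums.\<close>
  define f where "f = (\<lambda>k t. complex_of_real t powr (a - 1) * (1 - complex_of_real t) ^ n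
                     * complex_of_real (pochhammer s k / fact k * (z * t) ^ k))"
  define w where "w = (\<lambda>t. complex_of_real t powr (a - 1) * complex_of_real ((1 - t) powr (real (Suc n) - s - 1)))"
  have w: "set_integrable lborel {0<..<1} w"
    unfolding w_def using a s by (intro set_integrable_beta_kernel) auto
  have [measurable]: "f k \<in> borel_measurable lborel" "h \<in> borel_measurable lborel" for k
    unfolding f_def h_def by measurable
  have c: "pochhammer s k / fact k \<ge> 0" for k
    using s by (auto intro!: divide_nonneg_pos pochhammer_nonneg)
  have zt: "\<bar>z * t\<bar> < 1" "0 \<le> z * t" "1 - t \<le> 1 - z * t" if "t \<in> {0<..<1}" for t
  proof -
    have "z * t \<le> t" "0 \<le> z * t"
      using that z mult_right_mono[of z 1 t] by auto
    thus "\<bar>z * t\<bar> < 1" "0 \<le> z * t" "1 - t \<le> 1 - z * t"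
      using that unfolding greaterThanLessThan_iff by linarith+
  qed
  have sums: "(\<lambda>k. f k t) sums h t" if "t \<in> {0<..<1}" for t
    unfolding f_def h_def using zt[OF that]
    by (intro sums_mult) (simp only: sums_of_real_iff one_minus_powr_sums)
  have bound_h: "norm (h t) \<le> norm (w t)" if "t \<in> {0<..<1}" for t
  proof -
    have "(1 - t) ^ n * (1 - z * t) powr (- s) \<le> (1 - t) powr n * (1 - t) powr (- s)"
      using that zt[OF that] s by (intro mult_mono powr_mono2') (auto simp: powr_realpow)
    also have "\<dots> = (1 - t) powr (real (Suc n) - s - 1)"
      by (simp flip: powr_add)
    finally have "(1 - t) ^ n * (1 - z * t) powr (- s) \<le> (1 - t) powr (real (Suc n) - s - 1)" .
    moreover have "norm (1 - complex_of_real t) = 1 - t"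
      using that norm_of_real[of "1 - t", where 'a = complex] by simp
    ultimately show ?thesis
      unfolding h_def w_def norm_mult norm_power norm_of_real mult.assoc
      by (intro mult_left_mono norm_ge_zero) simp
  qed
  show h: "set_integrable lborel {0<..<1} h"
    by (rule set_integrable_bound[OF w]) (auto simp: set_borel_measurable_def bound_h)
  have bound: "norm (\<Sum>k<N. f k t) \<le> norm (w t)" if "t \<in> {0<..<1}" for N t
  proof -
    have "norm (\<Sum>k<N. f k t) = norm (complex_of_real t powr (a - 1) * (1 - complex_of_real t) ^ n)
             * \<bar>\<Sum>k<N. pochhammer s k / fact k * (z * t) ^ k\<bar>"
      unfolding f_def sum_distrib_left[symmetric] norm_mult of_real_sum[symmetric] norm_of_real ..
    also have "\<dots> \<le> norm (complex_of_real t powr (a - 1) * (1 - complex_of_real t) ^ n)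
             * \<bar>(1 - z * t) powr (- s)\<bar>"
    proof (intro mult_left_mono norm_ge_zero)
      have S: "(\<lambda>k. pochhammer s k / fact k * (z * t) ^ k) sums (1 - z * t) powr (- s)"
        by (rule one_minus_powr_sums) (use zt[OF that] in auto)
      have nn: "0 \<le> pochhammer s k / fact k * (z * t) ^ k" for k
        using c[of k] zt(2)[OF that] by (intro mult_nonneg_nonneg) auto
      have "(\<Sum>k<N. pochhammer s k / fact k * (z * t) ^ k) \<le> (1 - z * t) powr (- s)"
        using sum_le_suminf[OF sums_summable[OF S], of "{..<N}"] nn sums_unique[OF S] by simp
      thus "\<bar>\<Sum>k<N. pochhammer s k / fact k * (z * t) ^ k\<bar> \<le> \<bar>(1 - z * t) powr (- s)\<bar>"
        using nn by (subst (1) abs_of_nonneg) (auto intro!: sum_nonneg)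
    qed
    also have "\<dots> = norm (h t)" by (simp add: h_def norm_mult)
    also have "\<dots> \<le> norm (w t)" by (rule bound_h[OF that])
    finally show ?thesis .
  qed
  have int_f: "set_integrable lborel {0<..<1} (f k)"
    and val_f: "(LINT t:{0<..<1}|lborel. f k t) =
            fact n / pochhammer a (Suc n) * hypergeo_2F1_term (of_real s) a (a + of_nat (Suc n)) (of_real z) k" for k
  proof -
    let ?C = "complex_of_real (pochhammer s k / fact k * z ^ k)"
    let ?g = "\<lambda>t. complex_of_real t powr (a + of_nat k - 1) * (1 - complex_of_real t) ^ n"
    have eq: "f k t = ?C * ?g t" if "t \<in> {0<..<1}" for t
    proof -
      have "complex_of_real t powr (a + of_nat k - 1) = complex_of_real t powr (a - 1) * of_real t ^ k"
        using that powr_add[of "complex_of_real t" "a - 1" "of_nat k"] by (simp add: algebra_simps)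
      thus ?thesis by (simp add: f_def power_mult_distrib)
    qed
    have g: "set_integrable lborel {0<..<1} ?g"
      using a by (intro set_integrable_beta_kernel_nat) auto
    show "set_integrable lborel {0<..<1} (f k)"
      using set_integrable_mult_right[OF g, of ?C] eq
      by (subst set_integrable_cong[OF refl refl eq]) auto
    have "(LINT t:{0<..<1}|lborel. f k t) = (LINT t:{0<..<1}|lborel. ?C * ?g t)"
      by (intro set_lebesgue_integral_cong) (auto simp: eq)
    also have "\<dots> = ?C * fact n * (1 / pochhammer (a + of_nat k) (Suc n))"
      using a by (subst set_integral_mult_right, subst integral_beta_kernel_nat) auto
    also have "\<dots> = fact n / pochhammer a (Suc n) * hypergeo_2F1_term (of_real s) a (a + of_nat (Suc n)) (of_real z) k"
      unfolding pochhammer_shift_quotient[OF a]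
      by (simp add: hypergeo_2F1_term_def pochhammer_of_real mult_ac)
    finally show "(LINT t:{0<..<1}|lborel. f k t) = \<dots>" .
  qed
  have "(\<lambda>N. LINT t|lborel. indicator {0<..<1} t *\<^sub>R (\<Sum>k<N. f k t)) \<longlonglongrightarrow> (LINT t|lborel. indicator {0<..<1} t *\<^sub>R h t)"
  proof (rule integral_dominated_convergence)
    show "integrable lborel (\<lambda>t. norm (indicator {0<..<1} t *\<^sub>R w t))"
      using w unfolding set_integrable_def by (rule integrable_norm)
    show "AE t in lborel. (\<lambda>N. indicator {0<..<1} t *\<^sub>R (\<Sum>k<N. f k t)) \<longlonglongrightarrow> indicator {0<..<1} t *\<^sub>R h t"
      using sums by (auto simp: sums_def indicator_def)
    show "AE t in lborel. norm (indicator {0<..<1} t *\<^sub>R (\<Sum>k<N. f k t)) \<le> norm (indicator {0<..<1} t *\<^sub>R w t)" for N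
      using bound by (auto simp: indicator_def)
  qed measurable
  also have "(\<lambda>N. LINT t|lborel. indicator {0<..<1} t *\<^sub>R (\<Sum>k<N. f k t)) =
             (\<lambda>N. \<Sum>k<N. LINT t:{0<..<1}|lborel. f k t)"
    using int_f unfolding set_integrable_def set_lebesgue_integral_def
    by (simp only: scaleR_sum_right Bochner_Integration.integral_sum)
  finally have "(\<lambda>k. fact n / pochhammer a (Suc n) * hypergeo_2F1_term (of_real s) a (a + of_nat (Suc n)) (of_real z) k)
         sums (LINT t:{0<..<1}|lborel. h t)"
    unfolding sums_def val_f[symmetric] set_lebesgue_integral_def .
  from sums_mult[OF this, of "pochhammer a (Suc n) / fact n"]
  have "(\<lambda>k. pochhammer a (Suc n) / fact n * (fact n / pochhammer a (Suc n) * hypergeo_2F1_term (of_real s) a (a + of_nat (Suc n)) (of_real z) k))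
         sums (pochhammer a (Suc n) / fact n * (LINT t:{0<..<1}|lborel. h t))" .
  moreover have "a \<noteq> - of_nat j" for j
    using a by (auto simp: complex_eq_iff)
  hence "pochhammer a (Suc n) \<noteq> 0"
    unfolding pochhammer_eq_0_iff by blast
  ultimately show "hypergeo_2F1_term (of_real s) a (a + of_nat (Suc n)) (of_real z) sums
           (pochhammer a (Suc n) / fact n * (LINT t:{0<..<1}|lborel. h t))"
    by simp
qed

section \<open>Reduction of the integral over \<open>E2 b\<close>\<close>

text \<open>
  The functions in question may be unbounded at both ends of the interval, so the substitution is
  made for absolutely integrable functions on the open interval. Borel measurability of \<open>G\<close> then
  leads back from the completed measure to \<open>lborel\<close>.
\<close>
lemma set_integral_substitution_E2:
  fixes b :: real and H G :: "real \<Rightarrow> complex"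
  assumes b: "0 \<le> b" "b < 1"
    and H: "set_integrable lborel {0<..<1} H"
    and [measurable]: "G \<in> borel_measurable lborel"
    and G: "\<And>x. x \<in> {b<..<1} \<Longrightarrow> G x = complex_of_real (2 * x / (1 - b\<^sup>2)) * H ((1 - x\<^sup>2) / (1 - b\<^sup>2))"
  shows "set_integrable lborel {b<..<1} G"
    and "(LINT x:{b<..<1}|lborel. G x) = (LINT t:{0<..<1}|lborel. H t)"
proof -
  define g where "g = (\<lambda>x::real. (1 - x\<^sup>2) / (1 - b\<^sup>2))"
  have b2: "b\<^sup>2 < 1" using b by (simp add: power_less_one_iff abs_square_less_1)
  have der: "(g has_field_derivative - (2 * x / (1 - b\<^sup>2))) (at x within {b<..<1})" for x
    unfolding g_def using b2
    by (auto intro!: DERIV_cdivide derivative_eq_intros simp flip: minus_divide_left)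
  have inj: "inj_on g {b<..<1}"
    using b b2 by (auto simp: inj_on_def g_def power2_eq_iff_nonneg)
  have img: "g ` {b<..<1} = {0<..<1}"
  proof safe
    fix x assume x: "x \<in> {b<..<1}"
    hence "b\<^sup>2 < x\<^sup>2" "x\<^sup>2 < 1"
      using b by (auto intro: power_strict_mono simp: power_less_one_iff abs_square_less_1)
    thus "g x \<in> {0<..<1}" using b2 by (auto simp: g_def)
  next
    fix t :: real assume t: "t \<in> {0<..<1}"
    have *: "(1 - b\<^sup>2) * t < 1 - b\<^sup>2" "0 < (1 - b\<^sup>2) * t" using t b2 by auto
    have "sqrt (1 - (1 - b\<^sup>2) * t) < 1" using * by (subst real_sqrt_lt_1_iff) linarith
    moreover have "b < sqrt (1 - (1 - b\<^sup>2) * t)"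
      using * by (intro real_less_rsqrt) linarith
    moreover have "g (sqrt (1 - (1 - b\<^sup>2) * t)) = t"
      using * b2 zero_le_power2[of b] by (simp only: g_def real_sqrt_pow2) (simp add: field_simps)
    ultimately show "t \<in> g ` {b<..<1}" by (intro image_eqI[of _ _ "sqrt (1 - (1 - b\<^sup>2) * t)"]) auto
  qed
  have Gg: "\<bar>- (2 * x / (1 - b\<^sup>2))\<bar> *\<^sub>R H (g x) = G x" if "x \<in> {b<..<1}" for x
    using that b b2 by (simp add: G g_def scaleR_conv_of_real)
  have H': "H absolutely_integrable_on g ` {b<..<1}"
    unfolding img using H integrable_completion[of "\<lambda>t. indicator {0<..<1} t *\<^sub>R H t" lborel]
    by (auto simp: set_integrable_def dest: borel_measurable_integrable)
  have "(\<lambda>x. \<bar>- (2 * x / (1 - b\<^sup>2))\<bar> *\<^sub>R H (g x)) absolutely_integrable_on {b<..<1} \<and>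
        integral {b<..<1} (\<lambda>x. \<bar>- (2 * x / (1 - b\<^sup>2))\<bar> *\<^sub>R H (g x)) = integral {0<..<1} H"
    using H' img by (subst has_absolute_integral_change_of_variables_real[OF _ der inj]) auto
  moreover have "(\<lambda>x. \<bar>- (2 * x / (1 - b\<^sup>2))\<bar> *\<^sub>R H (g x)) absolutely_integrable_on {b<..<1}
                   \<longleftrightarrow> G absolutely_integrable_on {b<..<1}"
    by (intro set_integrable_cong refl Gg)
  moreover have "integral {b<..<1} (\<lambda>x. \<bar>- (2 * x / (1 - b\<^sup>2))\<bar> *\<^sub>R H (g x)) = integral {b<..<1} G"
    by (intro Henstock_Kurzweil_Integration.integral_cong Gg)
  ultimately have *: "G absolutely_integrable_on {b<..<1}" "integral {b<..<1} G = integral {0<..<1} H"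
    by simp_all
  show int: "set_integrable lborel {b<..<1} G"
    using *(1) unfolding set_integrable_def by (subst (asm) integrable_completion) auto
  show "(LINT x:{b<..<1}|lborel. G x) = (LINT t:{0<..<1}|lborel. H t)"
    using *(2) set_borel_integral_eq_integral(2)[OF int] set_borel_integral_eq_integral(2)[OF H] by simp
qed

lemma cos_phi_E2_square:
  assumes "b < \<bar>y\<bar>" "0 \<le> b" "b < 1"
  shows "(cos_phi_E2 b y)\<^sup>2 = (y\<^sup>2 - b\<^sup>2) / (1 - b\<^sup>2)"
proof -
  have "b\<^sup>2 < y\<^sup>2" "b\<^sup>2 < 1"
    using assms power_strict_mono[of b "\<bar>y\<bar>" 2] by (auto simp: abs_square_less_1)
  thus ?thesis using assms by (simp add: cos_phi_E2_def power_mult_distrib power_divide)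
qed

text \<open>
  Extending the fraction under the root in the weight by \<open>y + b\<close> makes the numerator a square, whose
  root is \<open>\<bar>y + b\<bar>\<close>. Since \<open>b < \<bar>y\<bar>\<close>, the numbers \<open>y + b\<close> and \<open>y\<close> have the same sign, so the sign
  carried by the cosine removes the absolute value. Hence one formula holds on both components.
\<close>
lemma cos_phi_E2_mult_w_E2:
  assumes "b < \<bar>y\<bar>" "\<bar>y\<bar> < 1" "0 \<le> b"
  shows "cos_phi_E2 b y * w_E2 b y = (y + b) / (1 - b\<^sup>2) / sqrt ((1 - y\<^sup>2) / (1 - b\<^sup>2))"
proof -
  have sq: "b\<^sup>2 < y\<^sup>2" "y\<^sup>2 < 1" "b\<^sup>2 < 1"
    using assms power_strict_mono[of b "\<bar>y\<bar>" 2] by (auto simp: abs_square_less_1)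
  have "(y + b) / ((1 - y\<^sup>2) * (y - b)) = (y + b)\<^sup>2 / ((1 - y\<^sup>2) * (y\<^sup>2 - b\<^sup>2))"
    using sq assms by (simp add: power2_eq_square divide_simps square_diff_square_factored)
  hence "w_E2 b y = \<bar>y + b\<bar> / (sqrt (1 - y\<^sup>2) * sqrt (y\<^sup>2 - b\<^sup>2))"
    by (simp add: w_E2_def real_sqrt_divide real_sqrt_mult)
  moreover have "y / \<bar>y\<bar> * \<bar>y + b\<bar> = y + b" using assms by (auto simp: abs_if)
  ultimately have "cos_phi_E2 b y * w_E2 b y = (y + b) / (sqrt (1 - b\<^sup>2) * sqrt (1 - y\<^sup>2))"
    using sq by (simp add: cos_phi_E2_def real_sqrt_divide divide_simps mult_ac)
  also have "\<dots> = (y + b) / (1 - b\<^sup>2) / sqrt ((1 - y\<^sup>2) / (1 - b\<^sup>2))"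
    using sq real_sqrt_mult_self[of "1 - b\<^sup>2"] by (simp add: real_sqrt_divide divide_simps)
  finally show ?thesis .
qed

lemma integrand_E2_eq:
  fixes \<mu> :: complex
  assumes "b < \<bar>y\<bar>" "\<bar>y\<bar> < 1" "0 \<le> b"
  defines "t \<equiv> (1 - y\<^sup>2) / (1 - b\<^sup>2)"
  shows "complex_of_real (cos_phi_E2 b y) ^ (2 * n + 1)
             * complex_of_real (1 - (cos_phi_E2 b y)\<^sup>2) powr \<mu>
             * complex_of_real (w_E2 b y)
         = complex_of_real ((y + b) / (1 - b\<^sup>2)) * (complex_of_real t powr (\<mu> - 1/2) * (1 - complex_of_real t) ^ n)"
proof -
  have sq: "y\<^sup>2 < 1" "b\<^sup>2 < 1"
    using assms by (auto simp: abs_square_less_1)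
  hence t: "t > 0" by (simp add: t_def)
  have c: "(cos_phi_E2 b y)\<^sup>2 = 1 - t"
    using assms sq by (subst cos_phi_E2_square) (auto simp: t_def field_simps)
  have "complex_of_real (cos_phi_E2 b y) ^ (2 * n + 1) = of_real (1 - t) ^ n * of_real (cos_phi_E2 b y)"
    by (simp add: power_mult flip: of_real_power c)
  hence "complex_of_real (cos_phi_E2 b y) ^ (2 * n + 1)
             * complex_of_real (1 - (cos_phi_E2 b y)\<^sup>2) powr \<mu>
             * complex_of_real (w_E2 b y)
      = of_real (1 - t) ^ n * complex_of_real t powr \<mu> * of_real (cos_phi_E2 b y * w_E2 b y)"
    by (simp only: c) (simp add: mult_ac)
  also have "\<dots> = of_real (1 - t) ^ n * complex_of_real t powr \<mu> * of_real ((y + b) / (1 - b\<^sup>2) / sqrt t)"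
    using assms by (simp only: cos_phi_E2_mult_w_E2 t_def)
  also have "of_real (sqrt t) = complex_of_real t powr (1/2)"
    using t powr_of_real[of t "1/2"] by (simp add: powr_half_sqrt)
  hence "of_real (1 - t) ^ n * complex_of_real t powr \<mu> * of_real ((y + b) / (1 - b\<^sup>2) / sqrt t) =
     complex_of_real ((y + b) / (1 - b\<^sup>2)) * (complex_of_real t powr (\<mu> - 1/2) * (1 - complex_of_real t) ^ n)"
    by (simp add: powr_diff)
  finally show ?thesis .
qed

theorem mainTheorem4:
  fixes n :: nat and \<mu> :: complex and b :: real
  assumes "Re \<mu> > -1/2" and "0 \<le> b" and "b < 1"
  shows "set_integrable lborel (E2 b)
           (\<lambda>x. complex_of_real (cos_phi_E2 b x) ^ (2 * n + 1)
             * complex_of_real (1 - (cos_phi_E2 b x)\<^sup>2) powr \<mu>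
             * complex_of_real (w_E2 b x))
    \<and> summable (hypergeo_2F1_term (1/2) (\<mu> + 1/2) (\<mu> + of_nat n + 3/2)
           (complex_of_real (1 - b\<^sup>2)))
    \<and> (LINT x:E2 b|lborel. complex_of_real (cos_phi_E2 b x) ^ (2 * n + 1)
             * complex_of_real (1 - (cos_phi_E2 b x)\<^sup>2) powr \<mu>
             * complex_of_real (w_E2 b x))
         = complex_of_real b
           * (Gamma (of_nat n + 1) * Gamma (\<mu> + 1/2) / Gamma (\<mu> + of_nat n + 3/2))
           * hypergeo_2F1 (1/2) (\<mu> + 1/2) (\<mu> + of_nat n + 3/2) (complex_of_real (1 - b\<^sup>2))"
proof -
  define F where "F = (\<lambda>x. complex_of_real (cos_phi_E2 b x) ^ (2 * n + 1)
             * complex_of_real (1 - (cos_phi_E2 b x)\<^sup>2) powr \<mu>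
             * complex_of_real (w_E2 b x))"
  define a where "a = \<mu> + 1/2"
  define h1 where "h1 = (\<lambda>t. complex_of_real t powr (a - 1) * (1 - complex_of_real t) ^ n)"
  define h2 where "h2 = (\<lambda>t. h1 t * complex_of_real ((1 - (1 - b\<^sup>2) * t) powr (- (1/2))))"
  have a: "Re a > 0" using assms by (simp add: a_def)
  have b2: "b\<^sup>2 < 1" using assms by (simp add: abs_square_less_1)
  note b = assms(2,3)
  have [measurable]: "F \<in> borel_measurable lborel"
    unfolding F_def cos_phi_E2_def w_E2_def by measurable
  have h1: "set_integrable lborel {0<..<1} h1"
    unfolding h1_def by (rule set_integrable_beta_kernel_nat[OF a])
  have h2: "set_integrable lborel {0<..<1} h2"
   and sums: "hypergeo_2F1_term (of_real (1/2)) a (a + of_nat (Suc n)) (of_real (1 - b\<^sup>2)) sums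
           (pochhammer a (Suc n) / fact n * (LINT t:{0<..<1}|lborel. h2 t))"
    using euler_integral_2F1[of a "1/2" n "1 - b\<^sup>2"] a b2 unfolding h1_def h2_def by simp_all
  have F_eq: "F y = of_real ((y + b) / (1 - b\<^sup>2)) * h1 ((1 - y\<^sup>2) / (1 - b\<^sup>2))"
    if "b < \<bar>y\<bar>" "\<bar>y\<bar> < 1" for y
    unfolding F_def integrand_E2_eq[OF that b(1)] by (simp add: h1_def a_def)
  have h2_eq: "h2 ((1 - x\<^sup>2) / (1 - b\<^sup>2)) = h1 ((1 - x\<^sup>2) / (1 - b\<^sup>2)) / of_real x" if "x \<in> {b<..<1}" for x
  proof -
    have "1 - (1 - b\<^sup>2) * ((1 - x\<^sup>2) / (1 - b\<^sup>2)) = x\<^sup>2" using b2 by simp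
    moreover have "(x\<^sup>2) powr (- (1/2)) = 1 / x"
      using that b by (simp add: powr_minus_divide powr_half_sqrt)
    ultimately show ?thesis by (simp add: h2_def)
  qed
  \<comment> \<open>With \<open>c = 1\<close> and \<open>c = - 1\<close> this exhibits the integrands on the right and on the left component,
     both pulled back to \<open>b < x < 1\<close>, as the absolute value of the derivative of the substitution times a function of \<open>t\<close>.
     The division by \<open>x\<close> is what introduces \<open>(1 - z * t) powr (- 1/2)\<close>, through \<open>h2_eq\<close>.\<close>
  have half: "complex_of_real (2 * x / (1 - b\<^sup>2)) * (c / 2 * u + of_real b / 2 * (u / of_real x)) =
       (c * of_real x + of_real b) / of_real (1 - b\<^sup>2) * u" if "x \<in> {b<..<1}" for x c u
  proof -
    have "x \<noteq> 0" using that b by auto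
    hence "of_real x * (c / 2 * u + of_real b / 2 * (u / of_real x)) = (c * of_real x + of_real b) / 2 * u"
      by (simp add: field_simps)
    moreover have "complex_of_real (2 * x / (1 - b\<^sup>2)) = 2 / of_real (1 - b\<^sup>2) * of_real x" by simp
    moreover have "2 / d * (p / 2 * u) = p / d * u" for d p :: complex by simp
    ultimately show ?thesis by (simp only: mult.assoc)
  qed
  have h12: "set_integrable lborel {0<..<1} (\<lambda>t. c / 2 * h1 t + of_real b / 2 * h2 t)"
            "(LINT t:{0<..<1}|lborel. c / 2 * h1 t + of_real b / 2 * h2 t) =
             c / 2 * (LINT t:{0<..<1}|lborel. h1 t) + of_real b / 2 * (LINT t:{0<..<1}|lborel. h2 t)" for c
    using set_integral_add[OF set_integrable_mult_right[OF h1] set_integrable_mult_right[OF h2], of "c / 2" "of_real b / 2"]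
    by simp_all
  have "F x = complex_of_real (2 * x / (1 - b\<^sup>2)) * (1 / 2 * h1 ((1 - x\<^sup>2) / (1 - b\<^sup>2)) + of_real b / 2 * h2 ((1 - x\<^sup>2) / (1 - b\<^sup>2)))"
    if "x \<in> {b<..<1}" for x
    using that b unfolding h2_eq[OF that] half[OF that] by (subst F_eq) auto
  note pos = set_integral_substitution_E2[OF b h12(1) _ this]
  have "F (- x) = complex_of_real (2 * x / (1 - b\<^sup>2)) * ((- 1) / 2 * h1 ((1 - x\<^sup>2) / (1 - b\<^sup>2)) + of_real b / 2 * h2 ((1 - x\<^sup>2) / (1 - b\<^sup>2)))"
    if "x \<in> {b<..<1}" for x
    using that b unfolding h2_eq[OF that] half[OF that] by (subst F_eq) auto
  note neg = set_integral_substitution_E2[OF b h12(1) _ this]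
  define N where "N = {x::real. - x \<in> {b<..<1}}"
  have intP: "set_integrable lborel {b<..<1} F" and intN: "set_integrable lborel {b<..<1} (\<lambda>x. F (- x))"
    by (rule pos(1) neg(1); measurable)+
  have intN': "set_integrable lborel N F"
    using lborel_integrable_real_affine[OF intN[unfolded set_integrable_def], of "- 1" 0]
    by (simp add: set_integrable_def N_def indicator_def)
  have valN: "(LINT x:N|lborel. F x) = (LINT x:{b<..<1}|lborel. F (- x))"
    unfolding N_def by (subst (2) set_integral_reflect) simp
  have N_eq: "N = {-1<..<-b}" by (auto simp: N_def)
  have N_sets [measurable]: "N \<in> sets lborel" unfolding N_eq by simp
  have [measurable]: "E2 b \<in> sets lborel" by (simp add: E2_def)
  have disj: "N \<inter> {b<..<1} = {}" using b by (auto simp: N_def)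
  \<comment> \<open>At the endpoints the integrand does not follow the formula used above.\<close>
  have "AE x in lborel. x \<notin> {-1, -b, b, 1}"
    by (intro AE_not_in countable_imp_null_set_lborel) auto
  hence ae: "AE x in lborel. x \<in> N \<union> {b<..<1} \<longleftrightarrow> x \<in> E2 b"
    by eventually_elim (auto simp: N_def E2_def)
  have intU: "set_integrable lborel (N \<union> {b<..<1}) F"
    by (intro set_integrable_Un intN' intP N_sets) auto
  have "set_integrable lborel (E2 b) F"
  proof -
    have "integrable lborel (\<lambda>x. indicator (N \<union> {b<..<1}) x *\<^sub>R F x) \<longleftrightarrow> integrable lborel (\<lambda>x. indicator (E2 b) x *\<^sub>R F x)"
      by (intro integrable_cong_AE) (use ae in \<open>auto simp: indicator_def\<close>)
    thus ?thesis using intU by (simp add: set_integrable_def)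
  qed
  moreover have "(LINT x:E2 b|lborel. F x) = of_real b * (LINT t:{0<..<1}|lborel. h2 t)"
  proof -
    \<comment> \<open>The \<open>h1\<close> parts of \<open>pos\<close> and \<open>neg\<close> cancel, the two halves of \<open>b * h2\<close> add up.\<close>
    have "(LINT x:E2 b|lborel. F x) = (LINT x:N \<union> {b<..<1}|lborel. F x)"
      using ae by (intro set_integral_cong_set) (auto simp: set_borel_measurable_def)
    also have "\<dots> = (LINT x:{b<..<1}|lborel. F (- x)) + (LINT x:{b<..<1}|lborel. F x)"
      using set_integral_Un[OF disj intN' intP] valN by simp
    also have "\<dots> = of_real b * (LINT t:{0<..<1}|lborel. h2 t)"
      by (subst pos(2), measurable, subst neg(2), measurable) (simp only: h12(2), simp)
    finally show ?thesis .
  qed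
  moreover have "of_real b * (Gamma (of_nat n + 1) * Gamma a / Gamma (a + of_nat (Suc n)))
                   * hypergeo_2F1 (1/2) a (a + of_nat (Suc n)) (of_real (1 - b\<^sup>2))
                 = of_real b * (LINT t:{0<..<1}|lborel. h2 t)"
  proof -
    define I where "I = (LINT t:{0<..<1}|lborel. h2 t)"
    have "hypergeo_2F1 (1/2) a (a + of_nat (Suc n)) (of_real (1 - b\<^sup>2)) = pochhammer a (Suc n) / fact n * I"
      using sums_unique[OF sums] by (simp add: hypergeo_2F1_def I_def del: of_nat_Suc)
    moreover have "Gamma (of_nat n + 1) * Gamma a / Gamma (a + of_nat (Suc n)) * (pochhammer a (Suc n) / fact n) = 1"
    proof -
      have "a \<notin> \<int>\<^sub>\<le>\<^sub>0" "a + of_nat (Suc n) \<notin> \<int>\<^sub>\<le>\<^sub>0"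
        using a by (auto elim!: nonpos_Ints_cases simp: complex_eq_iff)
      thus ?thesis
        using Gamma_fact[of n, where 'a = complex]
        by (simp add: pochhammer_Gamma Gamma_eq_zero_iff add_ac del: of_nat_Suc)
    qed
    moreover have "of_real b * u * (p * I) = of_real b * I" if "u * p = 1" for u p
      using that by (metis mult.assoc mult.commute mult_1)
    ultimately show ?thesis unfolding I_def[symmetric] by metis
  qed
  moreover have "\<mu> + of_nat n + 3/2 = a + of_nat (Suc n)" "\<mu> + 1/2 = a"
    by (simp_all add: a_def)
  moreover have "summable (hypergeo_2F1_term (1/2) a (a + of_nat (Suc n)) (of_real (1 - b\<^sup>2)))"
    using sums_summable[OF sums] by (simp del: of_nat_Suc)
  ultimately show ?thesis unfolding F_def by metis
qed

end
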